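(* Let $P,Q$ be integers, and let $\Delta$, $(u_n)$, $S$, $\mathcal P_{S,n}$ and "basic" be as defined in the context. (a) For $n\in S$, the set $\mathcal P_{S,n}$ is the set of primes dividing $u_n\Delta$. (b) Every element of $S$ can be written in the form $bp_1\cdots p_r$ for some $r\ge 0$, where $b\in S$ is (first kind) basic and, for $i=1,\dots,r$, the number $bp_1\cdots p_{i-1}$ is also in $S$, and $p_i$ is a prime in $\mathcal P_{S,bp_1\cdots p_{i-1}}$ (the primes $p_i$ need not be distinct). (c) The (first kind) basic elements of $S$ are - $1$ and $6$ if $P\equiv 3\pmod 6$ and $Q\equiv \pm1\pmod 6$; - $1$ and $12$ if $P\equiv \pm 1\pmod 6$ and $Q\equiv -1\pmod 6$; - $1$ only, otherwise.
   Context: For integers $P,Q$, put $\Delta=P^2-4Q$. The Lucas sequence of the first kind $(u_n)_{n\ge0}$ is given by $u_0=0$, $u_1=1$, $u_{n+2}=Pu_{n+1}-Qu_n$ for $n\ge0$. Let $S=S(P,Q)$ be the set of all integers $n\ge1$ such that $n$ divides $u_n$ (every positive integer divides $0$). For $n\in S$, $\mathcal P_{S,n}$ is the set of primes $p$ such that $np\in S$. An element $n\in S$ is called (first kind) basic if there is no prime $p$ such that $n/p$ is in $S$ (in particular $n/p$ would have to be an integer). *)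

theory Defs
  imports "HOL-Number_Theory.Cong"
begin

fun lucas_u :: "int \<Rightarrow> int \<Rightarrow> nat \<Rightarrow> int" where
  "lucas_u P Q 0 = 0"
| "lucas_u P Q (Suc 0) = 1"
| "lucas_u P Q (Suc (Suc n)) = P * lucas_u P Q (Suc n) - Q * lucas_u P Q n"

definition lucas_disc :: "int \<Rightarrow> int \<Rightarrow> int" where
  "lucas_disc P Q = P\<^sup>2 - 4 * Q"

definition lucas_S :: "int \<Rightarrow> int \<Rightarrow> nat set" where
  "lucas_S P Q = {n. n \<ge> 1 \<and> int n dvd lucas_u P Q n}"

definition lucas_P_S :: "int \<Rightarrow> int \<Rightarrow> nat \<Rightarrow> nat set" where
  "lucas_P_S P Q n = {p. prime p \<and> n * p \<in> lucas_S P Q}"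

text \<open>
  The conjunct \<open>p dvd n\<close> is needed because \<open>div\<close> on naturals truncates.
\<close>
definition lucas_basic :: "int \<Rightarrow> int \<Rightarrow> nat \<Rightarrow> bool" where
  "lucas_basic P Q n \<longleftrightarrow>
     n \<in> lucas_S P Q \<and> \<not> (\<exists>p. prime p \<and> p dvd n \<and> n div p \<in> lucas_S P Q)"

end

(*
  Along the multiples of m one has u_(mk) = u_m U_k, where U is again a Lucas sequence, with
  discriminant Delta * u_m^2.  A prime p divides the p-th term of a Lucas sequence iff it divides
  the discriminant, which gives (a); (b) is then immediate by descent.

  For (c), let p be a prime divisor of n in S.  A prime q | n with q not dividing Delta divides u_g
  for some g dividing both n and q - 1 or q + 1, and each further factor q in the index contributes
  a factor q to the term.  Hence n/p is in S as soon as all these g, for q different from p, divide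
  n/p.  For the largest prime p this can only fail if p = 3 and q = 2; the same criterion with p = 2
  then leaves n = 6 and n = 12.
*)

theory Submission
  imports Defs "HOL-Number_Theory.Residues"
begin


section \<open>Addition formulas and terms along multiples of an index\<close>

lemma lucas_u_Suc_add:
  "lucas_u P Q (Suc (m + n)) = lucas_u P Q (Suc m) * lucas_u P Q (Suc n) - Q * lucas_u P Q m * lucas_u P Q n"
proof (induction m arbitrary: n)
  case (Suc m)
  show ?case
    using Suc.IH[of "Suc n"] by (simp add: algebra_simps)
qed simp

lemma lucas_u_add:
  "lucas_u P Q (m + n) =
     lucas_u P Q m * lucas_u P Q (Suc n) + lucas_u P Q (Suc m) * lucas_u P Q n - P * lucas_u P Q m * lucas_u P Q n"
proof (cases n)
  case (Suc k)
  then show ?thesis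
    using lucas_u_Suc_add[of P Q m k] by (simp add: algebra_simps)
qed simp

text \<open>With alpha, beta the roots of X^2 - P X + Q, this is the product of u_(n+1) - beta u_n =
  alpha^n and u_(n+1) - alpha u_n = beta^n.\<close>

lemma lucas_u_norm:
  "(lucas_u P Q (Suc n))\<^sup>2 - P * lucas_u P Q (Suc n) * lucas_u P Q n + Q * (lucas_u P Q n)\<^sup>2 = Q ^ n"
proof (induction n)
  case (Suc n)
  show ?case
    by (simp add: Suc.IH[symmetric]) (simp add: algebra_simps power2_eq_square)
qed simp

text \<open>The companion sequence alpha^n + beta^n, with alpha, beta the roots of X^2 - P X +
  Q.\<close>

definition lucas_v :: "int \<Rightarrow> int \<Rightarrow> nat \<Rightarrow> int" where
  "lucas_v P Q n = 2 * lucas_u P Q (Suc n) - P * lucas_u P Q n"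

text \<open>alpha^m and beta^m have sum v_m and product Q^m, so the discriminant is (alpha^m -
  beta^m)^2.\<close>

lemma lucas_disc_multiple:
  "lucas_disc (lucas_v P Q m) (Q ^ m) = lucas_disc P Q * (lucas_u P Q m)\<^sup>2"
  unfolding lucas_disc_def lucas_v_def lucas_u_norm[of P Q m, symmetric]
  by (simp add: algebra_simps power2_eq_square)

lemma lucas_u_add_double:
  "lucas_u P Q (k + m + m) = lucas_v P Q m * lucas_u P Q (k + m) - Q ^ m * lucas_u P Q k"
  unfolding lucas_v_def lucas_u_norm[of P Q m, symmetric] lucas_u_add[of P Q "k + m" m]
    lucas_u_add[of P Q k m] lucas_u_Suc_add
  by (simp add: algebra_simps power2_eq_square)

lemma lucas_u_mult:
  "lucas_u P Q (m * n) = lucas_u P Q m * lucas_u (lucas_v P Q m) (Q ^ m) n"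
proof (induction n rule: induct_nat_012)
  case (ge2 n)
  have "lucas_u P Q (m * Suc (Suc n)) =
      lucas_v P Q m * lucas_u P Q (m * Suc n) - Q ^ m * lucas_u P Q (m * n)"
    using lucas_u_add_double[of P Q "m * n" m] by (simp add: algebra_simps)
  then show ?case
    by (simp add: ge2.IH algebra_simps del: mult_Suc_right)
qed simp_all

lemma lucas_u_dvd:
  assumes "m dvd n"
  shows "lucas_u P Q m dvd lucas_u P Q n"
  using assms by (auto simp: dvd_def lucas_u_mult)

section \<open>The term of prime index modulo that prime\<close>

text \<open>
  The binomial expansion of \<open>(P + \<surd>\<Delta>)\<^sup>n\<close> without the square root: the
  binomial transform turns the shift operator \<open>E\<close> into \<open>E - P\<close>, and the
  recurrence for \<open>2\<^sup>n u\<^sub>n\<close> reads \<open>(E - P)\<^sup>2 = \<Delta>\<close>.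
\<close>
lemma binomial_transform_Suc:
  fixes x :: "'a :: comm_ring_1" and f :: "nat \<Rightarrow> 'a"
  shows "(\<Sum>k\<le>Suc n. of_nat (Suc n choose k) * x ^ (Suc n - k) * f k) =
    x * (\<Sum>k\<le>n. of_nat (n choose k) * x ^ (n - k) * f k) +
    (\<Sum>k\<le>n. of_nat (n choose k) * x ^ (n - k) * f (Suc k))"
proof -
  have "(\<Sum>k\<le>Suc n. of_nat (Suc n choose k) * x ^ (Suc n - k) * f k) =
    x ^ Suc n * f 0 + (\<Sum>k\<le>n. of_nat (n choose Suc k) * x ^ (n - k) * f (Suc k)) +
    (\<Sum>k\<le>n. of_nat (n choose k) * x ^ (n - k) * f (Suc k))"
    by (subst sum.atMost_Suc_shift) (simp add: algebra_simps sum.distrib)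
  moreover have "x * (\<Sum>k\<le>n. of_nat (n choose k) * x ^ (n - k) * f k) =
      (\<Sum>k\<le>Suc n. of_nat (n choose k) * x ^ (Suc n - k) * f k)"
    by (auto simp: sum_distrib_left Suc_diff_le binomial_eq_0 algebra_simps intro!: sum.cong)
  moreover have "\<dots> = x ^ Suc n * f 0 + (\<Sum>k\<le>n. of_nat (n choose Suc k) * x ^ (n - k) * f (Suc k))"
    by (subst sum.atMost_Suc_shift) simp
  ultimately show ?thesis by simp
qed

lemma lucas_u_binomial:
  "2 ^ n * lucas_u P Q n =
    (\<Sum>k\<le>n. of_nat (n choose k) * P ^ (n - k) * (if odd k then 2 * lucas_disc P Q ^ (k div 2) else 0))"
proof -
  \<comment> \<open>Formally \<open>y k\<close> is (s^k - (-s)^k) / s with s^2 = Delta, so its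
    binomial transform is ((P + s)^n - (P - s)^n) / s = 2^n u_n.\<close>
  define y :: "nat \<Rightarrow> int" where "y k = (if odd k then 2 * lucas_disc P Q ^ (k div 2) else 0)" for k
  define B where "B f n = (\<Sum>k\<le>n. of_nat (n choose k) * P ^ (n - k) * f k)" for f :: "nat \<Rightarrow> int" and n
  have B_Suc: "B f (Suc n) = P * B f n + B (\<lambda>k. f (Suc k)) n" for f n
    unfolding B_def by (rule binomial_transform_Suc)
  have y2: "y (Suc (Suc k)) = lucas_disc P Q * y k" for k
    by (simp add: y_def)
  have By2: "B (\<lambda>k. y (Suc (Suc k))) n = lucas_disc P Q * B y n" for n
    by (simp add: y2 B_def sum_distrib_left algebra_simps)
  have "2 ^ n * lucas_u P Q n = B y n"
  proof (induction n rule: induct_nat_012)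
    case (ge2 n)
    have "B y (Suc (Suc n)) = 2 * P * B y (Suc n) - 4 * Q * B y n"
      unfolding B_Suc By2 by (simp add: lucas_disc_def algebra_simps power2_eq_square)
    then show ?case
      by (simp flip: ge2.IH add: algebra_simps)
  qed (simp_all add: B_def y_def)
  then show ?thesis by (simp add: B_def y_def)
qed

lemma fermat_theorem_int:
  fixes a :: int
  assumes "prime p" "\<not> int p dvd a"
  shows "[a ^ (p - 1) = 1] (mod int p)"
proof -
  define b where "b = nat (a mod int p)"
  have b: "int b = a mod int p"
    using assms(1) prime_gt_0_nat by (simp add: b_def)
  have "\<not> p dvd b"
    using assms(2) b by (metis dvd_mod_iff int_dvd_int_iff dvd_refl)
  then have "[int b ^ (p - 1) = 1] (mod int p)"
    using fermat_theorem[OF assms(1)] by (metis cong_int_iff of_nat_1 of_nat_power)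
  moreover have "[int b = a] (mod int p)"
    by (simp add: b cong_def)
  ultimately show ?thesis
    by (meson cong_pow cong_sym cong_trans)
qed

text \<open>Modulo p only the summand k = p of \<open>lucas_u_binomial\<close> survives. Oddness of
  p gives it the value 2 Delta^((p-1)/2) and makes 2 invertible; Fermat removes the remaining power
  of 2.\<close>

lemma lucas_u_prime_cong:
  assumes p: "prime p" "odd p"
  shows "[lucas_u P Q p = lucas_disc P Q ^ (p div 2)] (mod int p)"
proof -
  define y :: "nat \<Rightarrow> int" where "y k = (if odd k then 2 * lucas_disc P Q ^ (k div 2) else 0)" for k
  have "[of_nat (p choose k) * P ^ (p - k) * y k = (if k = p then y p else 0)] (mod int p)"
    if k: "k \<le> p" for k
  proof -
    consider "k = 0" | "k = p" | "0 < k" "k < p" using k by linarith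
    then show ?thesis
    proof cases
      case 3
      then have "p dvd (p choose k)"
        using p(1) by (intro dvd_choose_prime) auto
      then show ?thesis using 3 by (simp add: cong_0_iff)
    qed (auto simp: y_def)
  qed
  then have "[(\<Sum>k\<le>p. of_nat (p choose k) * P ^ (p - k) * y k) = (\<Sum>k\<le>p. if k = p then y p else 0)] (mod int p)"
    by (intro cong_sum) auto
  then have "[2 ^ p * lucas_u P Q p = 2 * lucas_disc P Q ^ (p div 2)] (mod int p)"
    using p by (simp add: lucas_u_binomial y_def)
  moreover have "(2 :: int) ^ p = 2 * 2 ^ (p - 1)"
    using p by (simp add: power_eq_if)
  ultimately have *: "[2 * (2 ^ (p - 1) * lucas_u P Q p) = 2 * lucas_disc P Q ^ (p div 2)] (mod int p)"
    by (simp add: mult.assoc)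
  have cop: "coprime 2 (int p)"
    using p(2) by (simp add: coprime_left_2_iff_odd)
  have "[2 ^ (p - 1) * lucas_u P Q p = lucas_disc P Q ^ (p div 2)] (mod int p)"
    using * cop by (simp add: cong_mult_lcancel)
  moreover have "\<not> int p dvd 2"
    using p by (metis even_numeral int_dvd_int_iff of_nat_numeral primes_dvd_imp_eq two_is_prime_nat)
  then have "[2 ^ (p - 1) * lucas_u P Q p = 1 * lucas_u P Q p] (mod int p)"
    by (intro cong_scalar_right fermat_theorem_int p)
  ultimately show ?thesis
    by (metis cong_sym cong_trans mult_1)
qed

lemma prime_dvd_lucas_u_prime_iff:
  assumes "prime p"
  shows "int p dvd lucas_u P Q p \<longleftrightarrow> int p dvd lucas_disc P Q"
proof (cases "odd p")
  case True
  with assms have "p div 2 > 0"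
    by (simp add: prime_ge_2_nat div_greater_zero_iff)
  then show ?thesis
    using cong_dvd_iff[OF lucas_u_prime_cong[OF assms True]] assms
    by (simp add: prime_dvd_power_iff)
next
  case False
  then have "p = 2"
    using assms primes_dvd_imp_eq[OF two_is_prime_nat] by auto
  \<comment> \<open>u_2 = P, and Delta = P^2 - 4Q has the parity of P.\<close>
  then show ?thesis by (simp add: lucas_disc_def numeral_2_eq_2)
qed

section \<open>Prime factors added to the index, and part (a)\<close>

text \<open>After cancelling the nonzero u_n, what remains is p | U_p, where U has parameters v_n,
  Q^n and discriminant Delta u_n^2.\<close>

lemma mult_lucas_u_dvd_iff:
  assumes "prime p" "lucas_u P Q n \<noteq> 0"
  shows "int p * lucas_u P Q n dvd lucas_u P Q (n * p) \<longleftrightarrow> int p dvd lucas_u P Q n * lucas_disc P Q"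
proof -
  have "prime (int p)" using assms(1) by simp
  then show ?thesis
    using assms prime_dvd_lucas_u_prime_iff[OF assms(1), of "lucas_v P Q n" "Q ^ n"]
    by (auto simp: lucas_u_mult lucas_disc_multiple prime_dvd_mult_iff prime_dvd_power_iff mult.commute)
qed

lemma mult_lucas_u_dvd:
  assumes "prime p" "int p dvd lucas_u P Q n * lucas_disc P Q"
  shows "int p * lucas_u P Q n dvd lucas_u P Q (n * p)"
  using assms mult_lucas_u_dvd_iff[of p P Q n] by (cases "lucas_u P Q n = 0") (auto simp: lucas_u_mult)

lemma power_mult_lucas_u_dvd:
  assumes "prime p" "int p dvd lucas_u P Q n * lucas_disc P Q"
  shows "int p ^ k * lucas_u P Q n dvd lucas_u P Q (n * p ^ k)"
proof (induction k)
  case (Suc k)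
  have "int p dvd lucas_u P Q (n * p ^ k) * lucas_disc P Q"
    using assms(2) lucas_u_dvd[of n "n * p ^ k" P Q] by (meson dvd_trans dvd_triv_left mult_dvd_mono dvd_refl)
  then have "int p * lucas_u P Q (n * p ^ k) dvd lucas_u P Q (n * p ^ Suc k)"
    using mult_lucas_u_dvd[OF assms(1), of P Q "n * p ^ k"] by (simp add: ac_simps)
  moreover have "int p ^ Suc k * lucas_u P Q n dvd int p * lucas_u P Q (n * p ^ k)"
    using Suc.IH by (simp add: mult.assoc)
  ultimately show ?case by (rule dvd_trans[rotated])
qed simp

text \<open>If p | u_n Delta, then np divides p u_n, which divides u_(np). Conversely, np | u_(np) =
  u_n U_p puts p into u_n or U_p, hence into u_n Delta. For u_n = 0 both sides hold.\<close>

lemma lucas_P_S_eq: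
  assumes "n \<in> lucas_S P Q"
  shows "lucas_P_S P Q n = {p. prime p \<and> int p dvd lucas_u P Q n * lucas_disc P Q}"
proof -
  have n: "n \<ge> 1" "int n dvd lucas_u P Q n"
    using assms by (auto simp: lucas_S_def)
  have "int (n * p) dvd lucas_u P Q (n * p) \<longleftrightarrow> int p dvd lucas_u P Q n * lucas_disc P Q"
    if p: "prime p" for p
  proof (cases "lucas_u P Q n = 0")
    case False
    have pi: "prime (int p)" using p by simp
    show ?thesis
    proof
      assume "int (n * p) dvd lucas_u P Q (n * p)"
      then have "int p dvd lucas_u P Q n * lucas_u (lucas_v P Q n) (Q ^ n) p"
        unfolding lucas_u_mult by (metis dvd_mult_right of_nat_mult)
      then show "int p dvd lucas_u P Q n * lucas_disc P Q"
        using pi prime_dvd_lucas_u_prime_iff[OF p, of "lucas_v P Q n" "Q ^ n"]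
        by (auto simp: lucas_disc_multiple prime_dvd_mult_iff prime_dvd_power_iff)
    next
      assume "int p dvd lucas_u P Q n * lucas_disc P Q"
      then have "int p * lucas_u P Q n dvd lucas_u P Q (n * p)"
        by (rule mult_lucas_u_dvd[OF p])
      moreover have "int (n * p) dvd int p * lucas_u P Q n"
        using n(2) by (simp add: mult.commute)
      ultimately show "int (n * p) dvd lucas_u P Q (n * p)"
        by (rule dvd_trans[rotated])
    qed
  qed (simp add: lucas_u_mult)
  then show ?thesis
    using n(1) by (auto simp: lucas_P_S_def lucas_S_def Suc_le_eq prime_gt_0_nat)
qed

section \<open>Indices of terms divisible by a given prime\<close>

lemma lucas_u_Suc_cong:
  assumes "p dvd Q"
  shows "[lucas_u P Q (Suc n) = P ^ n] (mod p)"
proof (induction n)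
  case (Suc n)
  have "[P * lucas_u P Q (Suc n) - Q * lucas_u P Q n = P * P ^ n - 0] (mod p)"
    using assms by (intro cong_diff cong_scalar_left Suc.IH) (simp add: cong_0_iff)
  then show ?case by simp
qed simp

lemma prime_not_dvd_Q:
  assumes "prime p" "int p dvd lucas_u P Q n" "n > 1" "\<not> int p dvd lucas_disc P Q"
  shows "\<not> int p dvd Q"
proof
  assume Q: "int p dvd Q"
  obtain m where m: "n = Suc m" "m > 0"
    using assms(3) by (cases n) auto
  have "int p dvd P ^ m"
    using assms(2) cong_dvd_iff[OF lucas_u_Suc_cong[OF Q, of P m]] m by simp
  then have "int p dvd P"
    using assms(1) m(2) by (simp add: prime_dvd_power_iff)
  then show False
    using Q assms(4) by (simp add: lucas_disc_def power2_eq_square)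
qed

text \<open>Subtractive Euclid on the indices. As p does not divide Q, \<open>lucas_u_norm\<close>
  keeps p from dividing both u_i and u_(i+1), so u_(i+1) can be cancelled in the addition
  formula.\<close>

lemma prime_dvd_lucas_u_gcd:
  assumes "prime p" "\<not> int p dvd Q"
  shows "int p dvd lucas_u P Q i \<Longrightarrow> int p dvd lucas_u P Q j \<Longrightarrow> int p dvd lucas_u P Q (gcd i j)"
proof (induction "i + j" arbitrary: i j rule: less_induct)
  case less
  have pi: "prime (int p)" using assms(1) by simp
  have step: "int p dvd lucas_u P Q k" if "int p dvd lucas_u P Q i" "int p dvd lucas_u P Q (i + k)" for i k
  proof -
    have "\<not> int p dvd Q ^ i"
      using assms(2) prime_dvd_power[OF pi] by blast
    then have "\<not> int p dvd lucas_u P Q (Suc i)"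
      using that(1) unfolding lucas_u_norm[of P Q i, symmetric]
      by (auto simp: power2_eq_square)
    moreover have "int p dvd lucas_u P Q (Suc i) * lucas_u P Q k"
    proof -
      have "lucas_u P Q (Suc i) * lucas_u P Q k =
          lucas_u P Q (i + k) - lucas_u P Q i * (lucas_u P Q (Suc k) - P * lucas_u P Q k)"
        by (simp only: lucas_u_add) (simp add: algebra_simps)
      then show ?thesis
        using that by simp
    qed
    ultimately show ?thesis
      using pi by (simp add: prime_dvd_mult_iff)
  qed
  consider "i = 0" | "j = 0" | k where "j = i + k" "i > 0" | k where "i = j + k" "j > 0"
    by (metis le_Suc_ex nat_le_linear neq0_conv)
  then show ?case
  proof cases
    case 3
    then have "int p dvd lucas_u P Q k"
      using less.prems step[of i k] by simp
    then have "int p dvd lucas_u P Q (gcd i k)"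
      using less.prems(1) 3 by (intro less.hyps) simp_all
    then show ?thesis using 3 by simp
  next
    case 4
    then have "int p dvd lucas_u P Q k"
      using less.prems step[of j k] by simp
    then have "int p dvd lucas_u P Q (gcd j k)"
      using less.prems(2) 4 by (intro less.hyps) simp_all
    then show ?thesis using 4 by (simp add: gcd.commute[of "j + k" j])
  qed (use less.prems in auto)
qed

text \<open>
  Legendre symbols are avoided: \<open>u\<^sub>p\<^sup>2 - u\<^sub>p\<^sub>-\<^sub>1 u\<^sub>p\<^sub>+\<^sub>1 = Q\<^bsup>p-1\<^esup>\<close>, where both
  \<open>u\<^sub>p\<^sup>2\<close> and \<open>Q\<^bsup>p-1\<^esup>\<close> are congruent to 1.
\<close>
lemma prime_dvd_lucas_u_adjacent:
  assumes p: "prime p" and D: "\<not> int p dvd lucas_disc P Q" and Q: "\<not> int p dvd Q"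
  shows "int p dvd lucas_u P Q (p - 1) \<or> int p dvd lucas_u P Q (Suc p)"
proof -
  have pi: "prime (int p)" using p by simp
  obtain m where m: "p = Suc m" using prime_gt_0_nat[OF p] by (cases p) auto
  have "\<not> int p dvd lucas_u P Q p"
    using D p by (simp add: prime_dvd_lucas_u_prime_iff)
  have "[(lucas_u P Q p)\<^sup>2 = 1] (mod int p)"
  proof (cases "odd p")
    case True
    have "[(lucas_u P Q p)\<^sup>2 = (lucas_disc P Q ^ (p div 2))\<^sup>2] (mod int p)"
      by (intro cong_pow lucas_u_prime_cong p True)
    also have "(lucas_disc P Q ^ (p div 2))\<^sup>2 = lucas_disc P Q ^ (p - 1)"
      using True by (simp add: odd_two_times_div_two_nat mult.commute flip: power_mult)
    also have "[\<dots> = 1] (mod int p)"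
      by (intro fermat_theorem_int p D)
    finally show ?thesis .
  next
    case False
    then have "p = 2"
      using p primes_dvd_imp_eq[OF two_is_prime_nat] by auto
    then show ?thesis
      using \<open>\<not> int p dvd lucas_u P Q p\<close> by (simp add: cong_iff_dvd_diff)
  qed
  moreover have "[Q ^ (p - 1) = 1] (mod int p)"
    by (intro fermat_theorem_int p Q)
  ultimately have "int p dvd (lucas_u P Q p)\<^sup>2 - Q ^ (p - 1)"
    by (metis cong_iff_dvd_diff cong_sym cong_trans)
  also have "(lucas_u P Q p)\<^sup>2 - Q ^ (p - 1) = lucas_u P Q (p - 1) * lucas_u P Q (Suc p)"
    using lucas_u_norm[of P Q m] by (simp add: m algebra_simps power2_eq_square)
  finally show ?thesis
    using pi by (simp add: prime_dvd_mult_iff)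
qed

text \<open>The witness is \<open>gcd n j\<close> with j = p - 1 or p + 1; it is coprime to p
  because j and p are neighbours. It stands in for the rank of apparition of p.\<close>

lemma lucas_S_prime_rank:
  assumes n: "n \<in> lucas_S P Q" and p: "prime p" "p dvd n" "\<not> int p dvd lucas_disc P Q"
  obtains g where "g dvd n" "g dvd p - 1 \<or> g dvd Suc p" "coprime g p" "int p dvd lucas_u P Q g"
proof -
  have "n > 1"
    using n p by (metis lucas_S_def mem_Collect_eq nat_less_le not_prime_1 nat_dvd_1_iff_1)
  have pn: "int p dvd lucas_u P Q n"
    using n p(2) by (metis (mono_tags) dvd_trans int_dvd_int_iff lucas_S_def mem_Collect_eq)
  have Q: "\<not> int p dvd Q"
    using prime_not_dvd_Q p(1,3) pn \<open>n > 1\<close> by blast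
  obtain j where j: "j = p - 1 \<or> j = Suc p" "int p dvd lucas_u P Q j"
    using prime_dvd_lucas_u_adjacent[OF p(1,3) Q] by blast
  have "coprime j p"
  proof -
    have "p = Suc (p - 1)" using prime_gt_0_nat[OF p(1)] by simp
    then show ?thesis
      using j(1) coprime_Suc_left_nat coprime_Suc_right_nat by metis
  qed
  then have "coprime (gcd n j) p"
    by (meson coprime_divisors dvd_refl gcd_dvd2)
  then show thesis
    using that[of "gcd n j"] j prime_dvd_lucas_u_gcd[OF p(1) Q pn j(2)] by auto
qed

section \<open>Descent from n to n/p\<close>

lemma dvd_if_prime_powers_dvd:
  assumes "m > 0" "\<And>q k. prime q \<Longrightarrow> q ^ k dvd m \<Longrightarrow> int (q ^ k) dvd x"
  shows "int m dvd x"
proof (cases "x = 0")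
  case False
  have "multiplicity q m \<le> multiplicity q (nat \<bar>x\<bar>)" if q: "prime q" for q
  proof (rule multiplicity_geI)
    show "q ^ multiplicity q m dvd nat \<bar>x\<bar>"
      using assms(2)[OF q multiplicity_dvd, of] False by (simp add: nat_dvd_iff)
  qed (use q False in auto)
  then show ?thesis
    using assms(1) multiplicity_le_imp_dvd[of m "nat \<bar>x\<bar>"] by simp
qed simp

text \<open>Each prime power q^k dividing n/p is treated separately. If q | Delta, the factor q^k of
  the index already contributes q^k to the term; otherwise an index g with q | u_g has to divide n/p
  as well.\<close>

lemma lucas_S_div:
  assumes n: "n \<in> lucas_S P Q" and p: "prime p" "p dvd n"
    and rank: "\<And>q g. \<lbrakk>prime q; q dvd n; q \<noteq> p; \<not> int q dvd lucas_disc P Q; g dvd n;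
      g dvd q - 1 \<or> g dvd Suc q\<rbrakk> \<Longrightarrow> g dvd n div p"
  shows "n div p \<in> lucas_S P Q"
proof -
  define m where "m = n div p"
  have nm: "n = p * m" using p by (simp add: m_def)
  have "n > 0" using n by (simp add: lucas_S_def)
  then have "m > 0" using nm by simp
  have "int (q ^ k) dvd lucas_u P Q m" if q: "prime q" and k: "q ^ k dvd m" for q k
  proof (cases "k = 0")
    case k0: False
    show ?thesis
    proof (cases "int q dvd lucas_disc P Q")
      case True
      obtain x where x: "m = x * q ^ k" using k by (metis dvd_def mult.commute)
      have "int q ^ k * lucas_u P Q x dvd lucas_u P Q m"
        unfolding x using True by (intro power_mult_lucas_u_dvd q) simp
      then show ?thesis by (simp add: dvd_mult_left)
    next
      case False
      have qn: "q dvd n"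
        using k k0 nm by (metis dvd_mult dvd_power dvd_trans neq0_conv)
      obtain g where g: "g dvd n" "g dvd q - 1 \<or> g dvd Suc q" "coprime g q" "int q dvd lucas_u P Q g"
        using lucas_S_prime_rank[OF n q qn False] by blast
      have "g dvd m"
      proof (cases "q = p")
        case True
        \<comment> \<open>Here g divides p * m and is coprime to p, so \<open>rank\<close> need only
          cover q different from p.\<close>
        then show ?thesis
          using g(1,3) by (simp add: nm coprime_dvd_mult_right_iff)
      next
        case False
        then show ?thesis
          using rank q qn g \<open>\<not> int q dvd lucas_disc P Q\<close> m_def by blast
      qed
      \<comment> \<open>Coprimality of g and q lets both factors sit in one index dividing
        m.\<close>
      then have "g * q ^ k dvd m"
        using k g(3) by (intro divides_mult) auto
      moreover have "int q ^ k * lucas_u P Q g dvd lucas_u P Q (g * q ^ k)"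
        using g(4) by (intro power_mult_lucas_u_dvd q) simp
      ultimately show ?thesis
        by (metis dvd_mult_left dvd_trans lucas_u_dvd of_nat_power)
    qed
  qed simp
  then have "int m dvd lucas_u P Q m"
    by (rule dvd_if_prime_powers_dvd[OF \<open>m > 0\<close>])
  then show ?thesis
    using \<open>m > 0\<close> by (simp add: lucas_S_def m_def)
qed

text \<open>The conditions on Delta are recorded because 2 and 3 turn out to be the primes at which
  the descent criterion fails; they later fix the residues of P and Q.\<close>

lemma lucas_basic_cases:
  assumes b: "lucas_basic P Q n" and "n \<noteq> 1"
  shows "(n = 6 \<or> n = 12) \<and> odd (lucas_disc P Q) \<and> \<not> 3 dvd lucas_disc P Q"
proof -
  have n: "n \<in> lucas_S P Q" and nb: "\<And>p. prime p \<Longrightarrow> p dvd n \<Longrightarrow> n div p \<notin> lucas_S P Q"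
    using b by (auto simp: lucas_basic_def)
  have "n > 1" using n \<open>n \<noteq> 1\<close> by (auto simp: lucas_S_def)
  obtain p where p: "p \<in> prime_factors n" "\<forall>q\<in>prime_factors n. q \<le> p"
  proof
    have "prime_factors n \<noteq> {}"
      using \<open>n > 1\<close> by (simp add: prime_factorization_empty_iff)
    then show "Max (prime_factors n) \<in> prime_factors n"
      by (intro Max_in) auto
  qed auto
  then have pp: "prime p" "p dvd n" and pmax: "\<And>q. prime q \<Longrightarrow> q dvd n \<Longrightarrow> q \<le> p"
    using \<open>n > 1\<close> by (auto simp: in_prime_factors_iff)
  obtain q g where q: "prime q" "q dvd n" "q \<noteq> p" "\<not> int q dvd lucas_disc P Q" "g dvd n"
      "g dvd q - 1 \<or> g dvd Suc q" "\<not> g dvd n div p"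
    using lucas_S_div[OF n pp] nb[OF pp] by blast
  \<comment> \<open>g divides p * (n div p) but not n div p.\<close>
  have "p dvd g"
  proof (rule ccontr)
    assume "\<not> p dvd g"
    then have "coprime g p"
      using pp(1) prime_imp_coprime coprime_commute by blast
    moreover have "g dvd p * (n div p)" using q(5) pp(2) by simp
    ultimately show False
      using q(7) by (simp add: coprime_dvd_mult_right_iff)
  qed
  have "q < p" using pmax[OF q(1,2)] q(3) by simp
  have "q - 1 > 0" using q(1) prime_gt_1_nat by auto
  \<comment> \<open>p divides q - 1 or q + 1 while q < p, which leaves p = q + 1; the only
    consecutive primes are 2 and 3.\<close>
  have "\<not> p dvd q - 1"
    using \<open>q < p\<close> \<open>q - 1 > 0\<close> by (auto dest: dvd_imp_le)
  then have "p dvd Suc q" "g dvd Suc q"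
    using q(6) \<open>p dvd g\<close> by (auto dest: dvd_trans)
  then have "p = Suc q"
    using \<open>q < p\<close> by (auto dest: dvd_imp_le)
  have "q = 2"
  proof (cases "even q")
    case True
    then show ?thesis using q(1) primes_dvd_imp_eq[OF two_is_prime_nat] by auto
  next
    case False
    then have "even p" using \<open>p = Suc q\<close> by simp
    then have "p = 2" using pp(1) primes_dvd_imp_eq[OF two_is_prime_nat] by auto
    then show ?thesis using \<open>p = Suc q\<close> q(1) by simp
  qed
  then have p3: "p = 3" using \<open>p = Suc q\<close> by simp
  have "g dvd 3" using \<open>g dvd Suc q\<close> \<open>q = 2\<close> by (simp add: numeral_3_eq_3 numeral_2_eq_2)
  have odd: "odd (lucas_disc P Q)" using q(4) \<open>q = 2\<close> by simp
  \<comment> \<open>g divides 3 but not n div 3, so 9 does not divide n.\<close>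
  have not3: "\<not> 3 dvd n div 3"
    using q(7) \<open>g dvd 3\<close> p3 by (auto dest: dvd_trans)
  have "3 dvd n" "even n" using pp q \<open>q = 2\<close> p3 by auto
  then have "6 dvd n" by presburger
  then obtain m where m: "n = 6 * m" by blast
  have n23: "r = 2 \<or> r = 3" if r: "prime r" "r dvd n" for r
  proof -
    have "r \<le> 3" "r \<ge> 2" using pmax[OF r] p3 prime_ge_2_nat[OF r(1)] by auto
    then show ?thesis by linarith
  qed
  \<comment> \<open>Division by 2 must fail too. The only other prime is 3, so g' divides 2 or 4;
    hence 4 does not divide n div 2, that is, 8 does not divide n.\<close>
  obtain q' g' where q': "prime q'" "q' dvd n" "q' \<noteq> 2" "\<not> int q' dvd lucas_disc P Q"
      "g' dvd q' - 1 \<or> g' dvd Suc q'" "\<not> g' dvd n div 2"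
    using lucas_S_div[OF n two_is_prime_nat \<open>even n\<close>] nb[OF two_is_prime_nat \<open>even n\<close>] by blast
  have "q' = 3" using n23 q' by blast
  then have D3: "\<not> 3 dvd lucas_disc P Q" using q'(4) by simp
  have "g' dvd 4"
    using q'(5) \<open>q' = 3\<close> dvd_trans[of g' 2 4] by auto
  then have not8: "\<not> 4 dvd n div 2"
    using q'(6) dvd_trans by blast
  have m2: "r = 2" if r: "prime r" "r dvd m" for r
    using n23[OF r(1)] r m not3 by (auto simp: dvd_mult)
  \<comment> \<open>Only the prime 2 can divide m, and 4 cannot, as n = 6 m is not divisible by
    8.\<close>
  have "m = 1 \<or> m = 2"
  proof (rule ccontr)
    assume "\<not> (m = 1 \<or> m = 2)"
    then obtain r where r: "prime r" "r dvd m" using prime_factor_nat by blast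
    then have "even m" using m2 by blast
    then obtain m' where m': "m = 2 * m'" by blast
    then have "m' \<noteq> 1" using \<open>\<not> (m = 1 \<or> m = 2)\<close> by simp
    then obtain r where r: "prime r" "r dvd m'" using prime_factor_nat by blast
    then have "even m'" using m2[OF r(1)] m' by auto
    then show False using not8 m m' by auto
  qed
  then show ?thesis using m odd D3 by auto
qed

section \<open>When 6 and 12 are basic\<close>

lemma lucas_u_explicit:
  "lucas_u P Q 2 = P"
  "lucas_u P Q 3 = P\<^sup>2 - Q"
  "lucas_u P Q 4 = P * (P\<^sup>2 - 2 * Q)"
  "lucas_u P Q 6 = P * (P\<^sup>2 - Q) * (P\<^sup>2 - 3 * Q)"
proof -
  show 2: "lucas_u P Q 2 = P"
    by (simp add: numeral_2_eq_2)
  show 3: "lucas_u P Q 3 = P\<^sup>2 - Q"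
    using lucas_u_Suc_add[of P Q 1 1] 2 by (simp add: numeral_2_eq_2 numeral_3_eq_3)
  show 4: "lucas_u P Q 4 = P * (P\<^sup>2 - 2 * Q)"
    using lucas_u.simps(3)[of P Q 2] 2 3 by (simp add: algebra_simps power2_eq_square del: lucas_u.simps)
  show "lucas_u P Q 6 = P * (P\<^sup>2 - Q) * (P\<^sup>2 - 3 * Q)"
    using lucas_u_add[of P Q 3 3] 3 4 by (simp add: algebra_simps power2_eq_square)
qed

text \<open>u_6 is even for odd P and Q, so only divisibility by 3 is at stake; modulo 3 its factor
  P^2 - 3Q is just P^2.\<close>

lemma six_in_lucas_S_iff:
  assumes "odd P" "odd Q"
  shows "6 \<in> lucas_S P Q \<longleftrightarrow> 3 dvd P * (P\<^sup>2 - Q)"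
proof -
  have six: "6 dvd x \<longleftrightarrow> 3 dvd x" if "even x" for x :: int
    using that by presburger
  have "6 \<in> lucas_S P Q \<longleftrightarrow> 6 dvd P * (P\<^sup>2 - Q) * (P\<^sup>2 - 3 * Q)"
    by (simp add: lucas_S_def lucas_u_explicit)
  also have "\<dots> \<longleftrightarrow> 3 dvd P * (P\<^sup>2 - Q) * (P\<^sup>2 - 3 * Q)"
    by (rule six) (use assms in simp)
  also have "\<dots> \<longleftrightarrow> 3 dvd P * (P\<^sup>2 - Q)"
  proof -
    have p3: "prime (3 :: int)" by simp
    have "3 dvd P\<^sup>2 - 3 * Q \<longleftrightarrow> 3 dvd P\<^sup>2" by (simp add: dvd_diff_left_iff)
    then show ?thesis
      using p3 by (auto simp: prime_dvd_mult_iff prime_dvd_power_iff)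
  qed
  finally show ?thesis .
qed

lemma three_dvd_square_diff:
  fixes x y :: int
  assumes "\<not> 3 dvd x"
  shows "3 dvd x\<^sup>2 - y \<longleftrightarrow> y mod 3 = 1"
proof -
  have "x mod 3 = 1 \<or> x mod 3 = 2" using assms by presburger
  then have "(x mod 3)\<^sup>2 mod 3 = 1" by auto
  then have "x\<^sup>2 mod 3 = 1" by (simp add: power_mod)
  then show ?thesis by (metis mod_eq_dvd_iff)
qed

lemma lucas_basic_div: "lucas_basic P Q n \<Longrightarrow> prime p \<Longrightarrow> p dvd n \<Longrightarrow> n div p \<notin> lucas_S P Q"
  by (auto simp: lucas_basic_def)

lemma prime_dvd_12:
  fixes p :: nat
  assumes "prime p" "p dvd 12"
  shows "p = 2 \<or> p = 3"
proof -
  have "p dvd 4 \<or> p dvd 3"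
    using prime_dvd_multD[OF assms(1), of 4 3] assms(2) by simp
  moreover have "p dvd 2" if "p dvd 4"
    using prime_dvd_multD[OF assms(1), of 2 2] that by simp
  ultimately show ?thesis
    using primes_dvd_imp_eq[OF assms(1), of 2] primes_dvd_imp_eq[OF assms(1), of 3] by auto
qed

text \<open>Necessary conditions common to 6 and 12; whether 3 divides P then separates the two. If
  3 does not divide P, then Delta is congruent to 1 - Q modulo 3, which rules out Q = 1 modulo
  3.\<close>

lemma lucas_basic_residues:
  assumes "lucas_basic P Q n" "n \<noteq> 1"
  shows "odd P" "odd Q" "\<not> 3 dvd Q" "3 dvd P \<or> Q mod 3 = 2"
proof -
  note c = lucas_basic_cases[OF assms]
  then have n: "n > 1" "2 dvd n" "3 dvd n" by auto
  have nu: "int n dvd lucas_u P Q n"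
    using assms(1) by (simp add: lucas_basic_def lucas_S_def)
  have "int q dvd lucas_u P Q n" if "q dvd n" for q
    using that by (intro dvd_trans[OF _ nu]) simp
  note u = this[OF n(2)] this[OF n(3)]
  show "odd P" using c by (simp add: lucas_disc_def)
  show "odd Q" using prime_not_dvd_Q[OF _ u(1) n(1)] c by simp
  show Q: "\<not> 3 dvd Q" using prime_not_dvd_Q[OF _ u(2) n(1)] c by simp
  have "Q mod 3 = 2" if "\<not> 3 dvd P"
  proof -
    have "\<not> 3 dvd P\<^sup>2 - 4 * Q" using c by (simp add: lucas_disc_def)
    then have "4 * Q mod 3 \<noteq> 1" using three_dvd_square_diff[OF that] by simp
    then show ?thesis using Q by presburger
  qed
  then show "3 dvd P \<or> Q mod 3 = 2" by blast
qed

lemma lucas_basic_6_iff: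
  "lucas_basic P Q 6 \<longleftrightarrow> [P = 3] (mod 6) \<and> ([Q = 1] (mod 6) \<or> [Q = -1] (mod 6))"
proof
  assume b: "lucas_basic P Q 6"
  note r = lucas_basic_residues[OF b, simplified]
  have "3 dvd P * (P\<^sup>2 - Q)"
    using b six_in_lucas_S_iff[OF r(1,2)] by (simp add: lucas_basic_def)
  then have "3 dvd P \<or> 3 dvd P\<^sup>2 - Q"
    by (simp add: prime_dvd_mult_iff)
  \<comment> \<open>Otherwise P^2 is 1 and Q is 2 modulo 3, so 3 cannot divide P^2 - Q.\<close>
  then have "3 dvd P"
    using r(4) three_dvd_square_diff[of P Q] by (metis numeral_eq_one_iff semiring_norm(85))
  then show "[P = 3] (mod 6) \<and> ([Q = 1] (mod 6) \<or> [Q = -1] (mod 6))"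
    using r(1-3) by (simp add: cong_def) presburger
next
  assume *: "[P = 3] (mod 6) \<and> ([Q = 1] (mod 6) \<or> [Q = -1] (mod 6))"
  then have "P mod 6 = 3" "Q mod 6 = 1 \<or> Q mod 6 = 5" by (simp_all add: cong_def)
  then have P: "odd P" "3 dvd P" and Q: "odd Q" "\<not> 3 dvd Q" by presburger+
  have "\<not> 3 dvd P\<^sup>2 - Q"
    using P(2) Q(2) by (simp add: dvd_diff_right_iff power2_eq_square)
  \<comment> \<open>The two quotients of 6 by a prime: u_2 = P is odd, and 3 does not divide u_3 =
    P^2 - Q.\<close>
  then have "2 \<notin> lucas_S P Q" "3 \<notin> lucas_S P Q"
    using P by (simp_all add: lucas_S_def lucas_u_explicit)
  then have "6 div p \<notin> lucas_S P Q" if "prime p" "p dvd 6" for p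
    using prime_dvd_12[OF that(1) dvd_trans[OF that(2)]] by auto
  moreover have "6 \<in> lucas_S P Q"
    using six_in_lucas_S_iff[OF P(1) Q(1)] P(2) by simp
  ultimately show "lucas_basic P Q 6"
    unfolding lucas_basic_def by blast
qed

lemma lucas_basic_12_iff:
  "lucas_basic P Q 12 \<longleftrightarrow> ([P = 1] (mod 6) \<or> [P = -1] (mod 6)) \<and> [Q = -1] (mod 6)"
proof
  assume b: "lucas_basic P Q 12"
  note r = lucas_basic_residues[OF b, simplified]
  have "6 \<notin> lucas_S P Q"
    using lucas_basic_div[OF b, of 2] by simp
  then have "\<not> 3 dvd P"
    using six_in_lucas_S_iff[OF r(1,2)] by auto
  then show "([P = 1] (mod 6) \<or> [P = -1] (mod 6)) \<and> [Q = -1] (mod 6)"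
    using r by (simp add: cong_def) presburger
next
  assume *: "([P = 1] (mod 6) \<or> [P = -1] (mod 6)) \<and> [Q = -1] (mod 6)"
  then have "P mod 6 = 1 \<or> P mod 6 = 5" "Q mod 6 = 5" by (simp_all add: cong_def)
  then have P: "odd P" "\<not> 3 dvd P" and Q: "odd Q" "Q mod 3 = 2" by presburger+
  have "\<not> 3 dvd P\<^sup>2 - Q" using three_dvd_square_diff[OF P(2)] Q(2) by simp
  then have "\<not> 3 dvd P * (P\<^sup>2 - Q)"
    using P(2) by (simp add: prime_dvd_mult_iff)
  then have S6: "6 \<notin> lucas_S P Q"
    using six_in_lucas_S_iff[OF P(1) Q(1)] by simp
  have S4: "4 \<notin> lucas_S P Q"
  proof
    assume "4 \<in> lucas_S P Q"
    then have "2 * 2 dvd P * (P\<^sup>2 - 2 * Q)"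
      by (simp add: lucas_S_def lucas_u_explicit)
    then have "2 dvd P * (P\<^sup>2 - 2 * Q)" by (rule dvd_mult_left)
    then show False using P(1) by simp
  qed
  \<comment> \<open>3 divides u_4, 4 divides u_6, and both u_4 and u_6 divide u_12.\<close>
  have "12 \<in> lucas_S P Q"
  proof -
    have "2 * Q mod 3 = 1" using Q(2) by presburger
    then have "3 dvd P\<^sup>2 - 2 * Q" using three_dvd_square_diff[OF P(2)] by simp
    then have "3 dvd lucas_u P Q 4" by (simp add: lucas_u_explicit)
    then have "3 dvd lucas_u P Q 12"
      using lucas_u_dvd[of 4 12 P Q] by (auto intro: dvd_trans)
    moreover have "4 dvd lucas_u P Q 12"
    proof -
      have "even (P\<^sup>2 - Q)" "even (P\<^sup>2 - 3 * Q)" using P(1) Q(1) by auto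
      then have "2 * 2 dvd (P\<^sup>2 - Q) * (P\<^sup>2 - 3 * Q)" by (rule mult_dvd_mono)
      then have "4 dvd lucas_u P Q 6"
        by (simp add: lucas_u_explicit mult.assoc)
      then show ?thesis
        using lucas_u_dvd[of 6 12 P Q] by (auto intro: dvd_trans)
    qed
    moreover have "12 dvd x" if "3 dvd x" "4 dvd x" for x :: int
      using that by presburger
    ultimately have "12 dvd lucas_u P Q 12" by blast
    then show ?thesis by (simp add: lucas_S_def)
  qed
  moreover have "12 div p \<notin> lucas_S P Q" if "prime p" "p dvd 12" for p
    using prime_dvd_12[OF that] S4 S6 by auto
  ultimately show "lucas_basic P Q 12"
    unfolding lucas_basic_def by blast
qed

section \<open>Chains from basic elements, and assembly\<close>

lemma lucas_basic_1: "lucas_basic P Q 1"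
  by (auto simp: lucas_basic_def lucas_S_def)

lemma lucas_S_chain:
  assumes "n \<in> lucas_S P Q"
  shows "\<exists>b ps. lucas_basic P Q b \<and> n = b * prod_list ps \<and>
    (\<forall>i < length ps. b * prod_list (take i ps) \<in> lucas_S P Q \<and>
      ps ! i \<in> lucas_P_S P Q (b * prod_list (take i ps)))"
  using assms
proof (induction n rule: less_induct)
  case (less n)
  show ?case
  proof (cases "lucas_basic P Q n")
    case True
    then show ?thesis
      by (intro exI[of _ n] exI[of _ "[]"]) auto
  next
    case False
    then obtain p where p: "prime p" "p dvd n" "n div p \<in> lucas_S P Q"
      using less.prems by (auto simp: lucas_basic_def)
    have "n div p < n"
      using less.prems prime_gt_1_nat[OF p(1)] by (intro div_less_dividend) (auto simp: lucas_S_def)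
    then obtain b ps where bps: "lucas_basic P Q b" "n div p = b * prod_list ps"
      "\<forall>i < length ps. b * prod_list (take i ps) \<in> lucas_S P Q \<and>
        ps ! i \<in> lucas_P_S P Q (b * prod_list (take i ps))"
      using less.IH[OF _ p(3)] by blast
    have "n = b * prod_list ps * p"
      using bps(2) p(2) by (metis dvd_div_mult_self)
    moreover have "p \<in> lucas_P_S P Q (b * prod_list ps)"
      using p(1) less.prems calculation by (simp add: lucas_P_S_def)
    \<comment> \<open>The removed prime goes to the end of the list: earlier prefixes are unchanged,
      and the one new prefix product is n div p.\<close>
    ultimately show ?thesis
      using bps p(3)
      by (intro exI[of _ b] exI[of _ "ps @ [p]"]) (auto simp: less_Suc_eq nth_append)
  qed
qed

theorem theorem1:
  fixes P Q :: int
  shows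
    "(\<forall>n \<in> lucas_S P Q.
        lucas_P_S P Q n = {p::nat. prime p \<and> int p dvd lucas_u P Q n * lucas_disc P Q}) \<and>
     (\<forall>n \<in> lucas_S P Q. \<exists>b ps.
        lucas_basic P Q b \<and>
        n = b * prod_list ps \<and>
        (\<forall>i < length ps.
           b * prod_list (take i ps) \<in> lucas_S P Q \<and>
           ps ! i \<in> lucas_P_S P Q (b * prod_list (take i ps)))) \<and>
     {n. lucas_basic P Q n} =
       (if [P = 3] (mod 6) \<and> ([Q = 1] (mod 6) \<or> [Q = -1] (mod 6)) then {1, 6}
        else if ([P = 1] (mod 6) \<or> [P = -1] (mod 6)) \<and> [Q = -1] (mod 6) then {1, 12}
        else {1})"
proof (intro conjI ballI)
  show "{n. lucas_basic P Q n} =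
       (if [P = 3] (mod 6) \<and> ([Q = 1] (mod 6) \<or> [Q = -1] (mod 6)) then {1, 6}
        else if ([P = 1] (mod 6) \<or> [P = -1] (mod 6)) \<and> [Q = -1] (mod 6) then {1, 12}
        else {1})"
  proof -
    have "n = 1 \<or> n = 6 \<or> n = 12" if "lucas_basic P Q n" for n
      using lucas_basic_cases[OF that] by blast
    \<comment> \<open>If 12 is basic, then 6 = 12/2 is not in S; so the two conditions of the case
      distinction exclude each other.\<close>
    moreover have "\<not> (lucas_basic P Q 6 \<and> lucas_basic P Q 12)"
      using lucas_basic_div[of P Q 12 2] by (auto simp: lucas_basic_def)
    ultimately show ?thesis
      unfolding lucas_basic_6_iff[symmetric] lucas_basic_12_iff[symmetric]
      using lucas_basic_1[of P Q] by (auto split: if_split)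
  qed
qed (rule lucas_P_S_eq lucas_S_chain, assumption)+

end
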